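(* Let $W$ be an Archimedean ordered $\mathbb{Q}$-vector space and $x\in W$. Then the following are equivalent: (a) $x\geq 0$; (b) $f(x)\geq 0$ for all functionals $f:W\to\mathbb{R}$.
   Context: An ordered $\mathbb{Q}$-vector space is a $\mathbb{Q}$-vector space $V$ with a positive cone $V_+\subseteq V$ that contains $0$, is closed under addition and under multiplication by nonnegative rationals, and is pointed ($x\in V_+$ and $-x\in V_+$ imply $x=0$); one writes $x\geq y$ iff $x-y\in V_+$. A subset $U\subseteq V$ is convex if $x,y\in U$ and rational $\lambda\in[0,1]$ imply $\lambda x+(1-\lambda)y\in U$; it is absolutely convex if it is convex and $V_+\subseteq U$; it is absorbent if for every $x\in V$ there is a rational $\mu>0$ with $\mu x\in U$. $W$ is Archimedean if $W_+$ equals the intersection of all absolutely convex absorbent subsets of $W$. A functional on $W$ is an additive map $f:W\to\mathbb{R}$ (hence $\mathbb{Q}$-linear) with $f(y)\geq 0$ for all $y\geq 0$. *)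

theory Defs
  imports Complex_Main
begin

locale ordered_rat_vector_space = vector_space scale
  for scale :: "rat \<Rightarrow> 'w \<Rightarrow> 'w::ab_group_add" (infixr \<open>*Q\<close> 75) +
  fixes pos_cone :: "'w set"
  assumes zero_in_pos_cone: "0 \<in> pos_cone"
    and add_in_pos_cone: "x \<in> pos_cone \<Longrightarrow> y \<in> pos_cone \<Longrightarrow> x + y \<in> pos_cone"
    and scale_in_pos_cone: "0 \<le> q \<Longrightarrow> x \<in> pos_cone \<Longrightarrow> q *Q x \<in> pos_cone"
    and pos_cone_pointed: "x \<in> pos_cone \<Longrightarrow> - x \<in> pos_cone \<Longrightarrow> x = 0"

definition cone_ge :: "'w::ab_group_add set \<Rightarrow> 'w \<Rightarrow> 'w \<Rightarrow> bool" where
  "cone_ge pos_cone x y \<longleftrightarrow> x - y \<in> pos_cone"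

definition rat_convex :: "(rat \<Rightarrow> 'w \<Rightarrow> 'w::ab_group_add) \<Rightarrow> 'w set \<Rightarrow> bool" where
  "rat_convex scale U \<longleftrightarrow>
    (\<forall>x\<in>U. \<forall>y\<in>U. \<forall>l. 0 \<le> l \<and> l \<le> 1 \<longrightarrow> scale l x + scale (1 - l) y \<in> U)"

text \<open>Here ``absolutely convex'' is relative to the positive cone; it does not mean
  convex and balanced.\<close>

definition absolutely_convex ::
    "(rat \<Rightarrow> 'w \<Rightarrow> 'w::ab_group_add) \<Rightarrow> 'w set \<Rightarrow> 'w set \<Rightarrow> bool" where
  "absolutely_convex scale pos_cone U \<longleftrightarrow> rat_convex scale U \<and> pos_cone \<subseteq> U"

definition rat_absorbent :: "(rat \<Rightarrow> 'w \<Rightarrow> 'w) \<Rightarrow> 'w set \<Rightarrow> bool" where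
  "rat_absorbent scale U \<longleftrightarrow> (\<forall>x. \<exists>m>0. scale m x \<in> U)"

definition archimedean_cone ::
    "(rat \<Rightarrow> 'w \<Rightarrow> 'w::ab_group_add) \<Rightarrow> 'w set \<Rightarrow> bool" where
  "archimedean_cone scale pos_cone \<longleftrightarrow>
    pos_cone = \<Inter>{U. absolutely_convex scale pos_cone U \<and> rat_absorbent scale U}"

definition positive_functional ::
    "'w::ab_group_add set \<Rightarrow> ('w \<Rightarrow> real) \<Rightarrow> bool" where
  "positive_functional pos_cone f \<longleftrightarrow>
    additive f \<and> (\<forall>y. cone_ge pos_cone y 0 \<longrightarrow> f y \<ge> 0)"

end

theory Submission
  imports Defs
begin

text \<open>
  Positive functionals are nonnegative on the cone by definition, so the content is separation: a
  point \<open>x\<close> outside the cone must be sent to a negative number by some positive functional.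

  Since the cone is the intersection of its absolutely convex absorbent supersets, some such
  superset \<open>U\<close> misses \<open>x\<close>. Its Minkowski gauge \<open>p z = Inf {t > 0. z \<in> t U}\<close> is
  sublinear over the rationals. It is at least \<open>1\<close> at \<open>x\<close>, and it vanishes on the cone because
  \<open>U\<close> contains every positive multiple of a cone element. By the Hahn--Banach theorem
  (\<open>Hahn_Banach_touching\<close>) an additive \<open>f \<le> p\<close> has \<open>f x = p x\<close>; hence \<open>- f\<close> is
  nonnegative on the cone and negative at \<open>x\<close>.

  The Hahn--Banach theorem is obtained without extending functionals from subspaces. Zorn's lemma
  gives a minimal element among the sublinear functionals below a given one. It is additive, for a
  sublinear \<open>q\<close> can be lowered in any direction \<open>y\<close> to a sublinear \<open>q'\<close> with
  \<open>q' z \<le> q (z + y) - q y\<close> (\<open>sublinear_lower_along\<close>); when \<open>q\<close> is minimal, \<open>q' = q\<close>, and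
  this is the missing superadditivity. Lowering \<open>p\<close> along \<open>x\<close> before minimising forces equality
  at \<open>x\<close>.

  The gauge, the lowered functional and the infimum of a chain are all pointwise infima of
  families of reals that behave like cones; \<open>sublinear_Inf\<close> handles the three at once.
\<close>

section \<open>Sublinear functionals as infima\<close>

locale rat_vector_space = vector_space scale
  for scale :: "rat \<Rightarrow> 'w \<Rightarrow> 'w::ab_group_add"
begin

definition sublinear :: "('w \<Rightarrow> real) \<Rightarrow> bool" where
  "sublinear p \<longleftrightarrow>
    (\<forall>y z. p (y + z) \<le> p y + p z) \<and> (\<forall>c z. 0 \<le> c \<longrightarrow> p (scale c z) = of_rat c * p z)"

lemma sublinear_add: "sublinear p \<Longrightarrow> p (y + z) \<le> p y + p z"
  and sublinear_scale: "sublinear p \<Longrightarrow> 0 \<le> c \<Longrightarrow> p (scale c z) = of_rat c * p z"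
  by (auto simp: sublinear_def)

lemma sublinear_zero: "sublinear p \<Longrightarrow> p 0 = 0"
  using sublinear_scale[of p 0 0] by simp

lemma sublinear_ge_neg: "sublinear p \<Longrightarrow> - p (- z) \<le> p z"
  using sublinear_add[of p z "- z"] sublinear_zero[of p] by simp

text \<open>
  Think of the pairs \<open>(z, r)\<close> with \<open>r \<in> R z\<close> as a convex cone in the product of the space with
  the real line: the lower boundary of a convex cone is the graph of a sublinear functional. The
  inequalities in the hypotheses leave room for families that form a cone only after passing to
  epigraphs. Scaling by \<open>c\<close> and by \<open>1 / c\<close> gives both directions of homogeneity, and the value
  \<open>0\<close> at the origin comes for free from doubling.
\<close>

lemma sublinear_Inf:
  fixes R :: "'w \<Rightarrow> real set"
  assumes nonempty: "\<And>z. R z \<noteq> {}"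
    and bounded: "\<And>z. bdd_below (R z)"
    and add: "\<And>y z r s. r \<in> R y \<Longrightarrow> s \<in> R z \<Longrightarrow> \<exists>t\<in>R (y + z). t \<le> r + s"
    and scale: "\<And>c z r. 0 < c \<Longrightarrow> r \<in> R z \<Longrightarrow> \<exists>t\<in>R (scale c z). t \<le> of_rat c * r"
  shows "sublinear (\<lambda>z. Inf (R z))"
proof -
  have subadd: "Inf (R (y + z)) \<le> Inf (R y) + Inf (R z)" for y z
  proof -
    have "Inf (R (y + z)) \<le> r + s" if "r \<in> R y" "s \<in> R z" for r s
      using add[OF that] cInf_lower[OF _ bounded] order_trans by blast
    then have "Inf (R (y + z)) - r \<le> Inf (R z)" if "r \<in> R y" for r
      using that by (intro cInf_greatest[OF nonempty]) (metis diff_le_eq add.commute)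
    then have "Inf (R (y + z)) - Inf (R z) \<le> Inf (R y)"
      by (intro cInf_greatest[OF nonempty]) (auto simp: algebra_simps)
    then show ?thesis
      by simp
  qed
  have scale_le: "Inf (R (scale c z)) \<le> of_rat c * Inf (R z)" if c: "0 < c" for c z
  proof -
    have pos: "(0::real) < of_rat c"
      using c by simp
    have "Inf (R (scale c z)) \<le> of_rat c * r" if "r \<in> R z" for r
      using scale[OF c that] cInf_lower[OF _ bounded] order_trans by blast
    then have "Inf (R (scale c z)) / of_rat c \<le> Inf (R z)"
      using pos by (intro cInf_greatest[OF nonempty]) (simp add: pos_divide_le_eq mult.commute)
    then show ?thesis
      using pos by (simp add: pos_divide_le_eq mult.commute)
  qed
  have scale_eq: "Inf (R (scale c z)) = of_rat c * Inf (R z)" if c: "0 < c" for c z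
  proof (rule antisym[OF scale_le[OF c]])
    have "Inf (R z) \<le> of_rat (1 / c) * Inf (R (scale c z))"
      using scale_le[of "1 / c" "scale c z"] c by simp
    then show "of_rat c * Inf (R z) \<le> Inf (R (scale c z))"
      using c by (simp add: of_rat_divide pos_le_divide_eq mult.commute)
  qed
  have "Inf (R 0) = 0"
    using scale_eq[of 2 0] by simp
  then have "Inf (R (scale c z)) = of_rat c * Inf (R z)" if "0 \<le> c" for c z
    using scale_eq[of c z] that by (cases "c = 0") auto
  with subadd show ?thesis
    by (simp add: sublinear_def)
qed

text \<open>
  For fixed \<open>z\<close> the quantity \<open>q (z + t y) - t q y\<close> does not increase with \<open>t\<close>, and it stays above
  \<open>- q (- z)\<close> because \<open>t q y = q (t y) \<le> q (z + t y) + q (- z)\<close>. Its limit, that is, its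
  infimum over \<open>t \<ge> 0\<close>, is the functional sought: \<open>t = 0\<close> and \<open>t = 1\<close> give the two upper bounds.
\<close>

lemma sublinear_lower_along:
  assumes q: "sublinear q"
  obtains q' where "sublinear q'" "\<And>z. q' z \<le> q z" "\<And>z. q' z \<le> q (z + y) - q y"
proof
  define R where "R z = {q (z + scale t y) - of_rat t * q y | t. 0 \<le> t}" for z
  have mem: "q (z + scale t y) - of_rat t * q y \<in> R z" if "0 \<le> t" for t z
    using that by (auto simp: R_def)
  have bounded: "bdd_below (R z)" for z
  proof (rule bdd_belowI)
    fix r assume "r \<in> R z"
    then obtain t where t: "0 \<le> t" and r: "r = q (z + scale t y) - of_rat t * q y"
      by (auto simp: R_def)
    show "- q (- z) \<le> r"
      using sublinear_add[OF q, of "z + scale t y" "- z"] sublinear_scale[OF q t, of y]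
      by (simp add: r)
  qed
  show "sublinear (\<lambda>z. Inf (R z))"
  proof (rule sublinear_Inf[OF _ bounded])
    show "R z \<noteq> {}" for z
      using mem[of 0 z] by auto
  next
    fix v w r s assume "r \<in> R v" "s \<in> R w"
    then obtain t u where t: "0 \<le> t" "r = q (v + scale t y) - of_rat t * q y"
      and u: "0 \<le> u" "s = q (w + scale u y) - of_rat u * q y"
      by (auto simp: R_def)
    have "v + w + scale (t + u) y = (v + scale t y) + (w + scale u y)"
      by (simp add: scale_left_distrib algebra_simps)
    then have "q (v + w + scale (t + u) y) - of_rat (t + u) * q y \<le> r + s"
      using sublinear_add[OF q, of "v + scale t y" "w + scale u y"] t u
      by (simp add: of_rat_add algebra_simps)
    with mem[of "t + u" "v + w"] t u show "\<exists>t\<in>R (v + w). t \<le> r + s"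
      by auto
  next
    fix c z r assume c: "(0::rat) < c" and "r \<in> R z"
    then obtain t where t: "0 \<le> t" "r = q (z + scale t y) - of_rat t * q y"
      by (auto simp: R_def)
    have "q (scale c z + scale (c * t) y) = of_rat c * q (z + scale t y)"
      using sublinear_scale[OF q, of c "z + scale t y"] c by (simp add: scale_right_distrib)
    then have "q (scale c z + scale (c * t) y) - of_rat (c * t) * q y \<le> of_rat c * r"
      by (simp add: t(2) of_rat_mult right_diff_distrib)
    with mem[of "c * t" "scale c z"] t c show "\<exists>t\<in>R (scale c z). t \<le> of_rat c * r"
      by (intro bexI) auto
  qed
  show "Inf (R z) \<le> q z" for z
    using cInf_lower[OF mem[of 0 z] bounded] by simp
  show "Inf (R z) \<le> q (z + y) - q y" for z
    using cInf_lower[OF mem[of 1 z] bounded] by simp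
qed

text \<open>
  The pointwise infimum of a chain is finite because every sublinear \<open>q \<le> p\<close> satisfies
  \<open>q z \<ge> - q (- z) \<ge> - p (- z)\<close>. It is subadditive because values of two members of the chain
  can be compared within the smaller of the two.
\<close>

lemma sublinear_chain_lower_bound:
  assumes C: "C \<noteq> {}" "\<And>q. q \<in> C \<Longrightarrow> sublinear q" "\<And>q. q \<in> C \<Longrightarrow> q \<le> p"
    and chain: "\<And>q q'. q \<in> C \<Longrightarrow> q' \<in> C \<Longrightarrow> q \<le> q' \<or> q' \<le> q"
  obtains u where "sublinear u" "u \<le> p" "\<And>q. q \<in> C \<Longrightarrow> u \<le> q"
proof
  define R where "R z = (\<lambda>q. q z) ` C" for z
  have bounded: "bdd_below (R z)" for z
  proof (rule bdd_belowI)
    fix r assume "r \<in> R z"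
    then obtain q where q: "q \<in> C" "r = q z"
      by (auto simp: R_def)
    show "- p (- z) \<le> r"
      using sublinear_ge_neg[OF C(2)[OF q(1)], of z] le_funD[OF C(3)[OF q(1)], of "- z"] q(2)
      by simp
  qed
  have lower: "Inf (R z) \<le> q z" if "q \<in> C" for q z
    using that by (intro cInf_lower[OF _ bounded]) (auto simp: R_def)
  show "sublinear (\<lambda>z. Inf (R z))"
  proof (rule sublinear_Inf[OF _ bounded])
    show "R z \<noteq> {}" for z
      using C(1) by (simp add: R_def)
  next
    fix y z r s assume "r \<in> R y" "s \<in> R z"
    then obtain q q' where q: "q \<in> C" "r = q y" and q': "q' \<in> C" "s = q' z"
      by (auto simp: R_def)
    obtain m where m: "m \<in> C" "m \<le> q" "m \<le> q'"
      using chain[OF q(1) q'(1)] q(1) q'(1) by blast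
    have "m (y + z) \<le> r + s"
      using sublinear_add[OF C(2)[OF m(1)], of y z] le_funD[OF m(2), of y] le_funD[OF m(3), of z]
        q(2) q'(2) by simp
    with m(1) show "\<exists>t\<in>R (y + z). t \<le> r + s"
      by (auto simp: R_def)
  next
    fix c z r assume "(0::rat) < c" "r \<in> R z"
    then show "\<exists>t\<in>R (scale c z). t \<le> of_rat c * r"
      using sublinear_scale[OF C(2)] by (auto simp: R_def)
  qed
  show "(\<lambda>z. Inf (R z)) \<le> q" if "q \<in> C" for q
    using lower[OF that] by (simp add: le_fun_def)
  then show "(\<lambda>z. Inf (R z)) \<le> p"
    using C(1,3) order_trans by blast
qed

section \<open>The Hahn--Banach theorem\<close>

lemma Hahn_Banach:
  assumes p: "sublinear p"
  obtains f where "additive f" "f \<le> p"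
proof -
  define A where "A = {q. sublinear q \<and> q \<le> p}"
  have "\<exists>m\<in>A. \<forall>a\<in>A. m \<ge> a \<longrightarrow> a = m"
  proof (rule predicate_Zorn)
    show "partial_order_on A (relation_of (\<ge>) A)"
      by (rule partial_order_on_relation_ofI) auto
  next
    fix C assume "C \<in> Chains (relation_of (\<ge>) A)"
    then have sub: "C \<subseteq> A" and chain: "\<And>q q'. q \<in> C \<Longrightarrow> q' \<in> C \<Longrightarrow> q \<le> q' \<or> q' \<le> q"
      by (auto simp: Chains_def relation_of_def)
    show "\<exists>u\<in>A. \<forall>a\<in>C. u \<le> a"
    proof (cases "C = {}")
      case True
      with p show ?thesis
        by (auto simp: A_def)
    next
      case False
      obtain u where "sublinear u" "u \<le> p" "\<And>q. q \<in> C \<Longrightarrow> u \<le> q"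
        by (rule sublinear_chain_lower_bound[of C p]) (use sub chain False in \<open>auto simp: A_def\<close>)
      then show ?thesis
        by (auto simp: A_def)
    qed
  qed
  then obtain m where m: "sublinear m" "m \<le> p"
    and minimal: "\<And>q. sublinear q \<Longrightarrow> q \<le> m \<Longrightarrow> q = m"
    unfolding A_def by (auto intro: order_trans)
  have "m (z + y) = m z + m y" for z y
  proof (rule antisym[OF sublinear_add[OF m(1)]])
    obtain q where q: "sublinear q" "\<And>z. q z \<le> m z" "\<And>z. q z \<le> m (z + y) - m y"
      using sublinear_lower_along[OF m(1), of y] by blast
    have "q = m"
      by (rule minimal) (use q in \<open>auto simp: le_fun_def\<close>)
    with q(3)[of z] show "m z + m y \<le> m (z + y)"
      by simp
  qed
  then have "additive m"
    by (simp add: additive_def)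
  with m(2) that show thesis
    by blast
qed

text \<open>
  Lowering \<open>p\<close> along \<open>x\<close> brings its value at \<open>- x\<close> down to at most \<open>- p x\<close>. An additive \<open>f\<close> below
  the lowered functional therefore has \<open>- f x \<le> - p x\<close>, so \<open>f\<close> touches \<open>p\<close> at \<open>x\<close>.
\<close>

lemma Hahn_Banach_touching:
  assumes p: "sublinear p"
  obtains f where "additive f" "f \<le> p" "f x = p x"
proof -
  obtain q where q: "sublinear q" "\<And>z. q z \<le> p z" "\<And>z. q z \<le> p (z + x) - p x"
    using sublinear_lower_along[OF p, of x] by blast
  obtain f where f: "additive f" "f \<le> q"
    using Hahn_Banach[OF q(1)] by blast
  have below: "f \<le> p"
    using f(2) q(2) by (auto simp: le_fun_def intro: order_trans)
  have "f (- x) \<le> - p x"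
    using le_funD[OF f(2), of "- x"] q(3)[of "- x"] sublinear_zero[OF p] by simp
  then have "p x \<le> f x"
    by (simp add: additive.minus[OF f(1)])
  with below that[OF f(1) below] show thesis
    by (simp add: le_fun_def antisym)
qed

section \<open>The Minkowski gauge\<close>

definition gauge :: "'w set \<Rightarrow> 'w \<Rightarrow> real" where
  "gauge U z = Inf {of_rat t | t. 0 < t \<and> scale (1 / t) z \<in> U}"

lemma bdd_below_gauge_set: "bdd_below {real_of_rat t | t. 0 < t \<and> scale (1 / t) z \<in> U}"
  by (rule bdd_belowI[of _ 0]) auto

lemma gauge_le: "0 < t \<Longrightarrow> scale (1 / t) z \<in> U \<Longrightarrow> gauge U z \<le> of_rat t"
  unfolding gauge_def by (rule cInf_lower[OF _ bdd_below_gauge_set]) auto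

lemma gauge_set_nonempty:
  assumes "rat_absorbent scale U"
  shows "{real_of_rat t | t. 0 < t \<and> scale (1 / t) z \<in> U} \<noteq> {}"
proof -
  obtain m where m: "0 < m" "scale m z \<in> U"
    using assms by (auto simp: rat_absorbent_def)
  have "0 < 1 / m" "scale (1 / (1 / m)) z \<in> U"
    using m by simp_all
  then show ?thesis
    by blast
qed

text \<open>
  Subadditivity is convexity: if \<open>y \<in> t U\<close> and \<open>z \<in> u U\<close>, then \<open>(y + z) / (t + u)\<close> is the
  convex combination of \<open>y / t\<close> and \<open>z / u\<close> with weights \<open>t / (t + u)\<close> and \<open>u / (t + u)\<close>.
\<close>

lemma sublinear_gauge:
  assumes convex: "rat_convex scale U" and absorbent: "rat_absorbent scale U"
  shows "sublinear (gauge U)"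
  unfolding gauge_def
proof (rule sublinear_Inf[OF gauge_set_nonempty[OF absorbent] bdd_below_gauge_set])
  fix y z r s
  assume "r \<in> {real_of_rat t | t. 0 < t \<and> scale (1 / t) y \<in> U}"
    and "s \<in> {real_of_rat t | t. 0 < t \<and> scale (1 / t) z \<in> U}"
  then obtain t u where t: "0 < t" "scale (1 / t) y \<in> U" "r = of_rat t"
    and u: "0 < u" "scale (1 / u) z \<in> U" "s = of_rat u"
    by auto
  define l where "l = t / (t + u)"
  have l: "0 \<le> l" "l \<le> 1" "1 - l = u / (t + u)"
    using t(1) u(1) by (auto simp: l_def field_simps)
  have "scale l (scale (1 / t) y) + scale (1 - l) (scale (1 / u) z) \<in> U"
    using convex t(2) u(2) l(1,2) unfolding rat_convex_def by blast
  moreover have "l * (1 / t) = 1 / (t + u)" "(1 - l) * (1 / u) = 1 / (t + u)"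
    using t(1) u(1) by (simp_all add: l(3), simp_all add: l_def)
  ultimately have "scale (1 / (t + u)) (y + z) \<in> U"
    by (simp only: scale_scale scale_right_distrib)
  moreover have "r + s = of_rat (t + u)"
    using t u by (simp add: of_rat_add)
  ultimately show "\<exists>v\<in>{real_of_rat t | t. 0 < t \<and> scale (1 / t) (y + z) \<in> U}. v \<le> r + s"
    using t(1) u(1) by (intro bexI[of _ "r + s"] CollectI exI[of _ "t + u"]) auto
next
  fix c z r
  assume c: "(0::rat) < c" and "r \<in> {real_of_rat t | t. 0 < t \<and> scale (1 / t) z \<in> U}"
  then obtain t where t: "0 < t" "scale (1 / t) z \<in> U" "r = of_rat t"
    by auto
  then have "scale (1 / (c * t)) (scale c z) \<in> U"
    using c by simp
  then show "\<exists>v\<in>{real_of_rat t | t. 0 < t \<and> scale (1 / t) (scale c z) \<in> U}. v \<le> of_rat c * r"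
    using c t by (intro bexI[of _ "of_rat c * r"] CollectI exI[of _ "c * t"]) (auto simp: of_rat_mult)
qed

text \<open>
  If \<open>x / t \<in> U\<close> with \<open>t \<le> 1\<close>, then \<open>x\<close> lies on the segment from \<open>0\<close> to \<open>x / t\<close>, hence in \<open>U\<close>.
\<close>

lemma gauge_ge_1:
  assumes convex: "rat_convex scale U" and absorbent: "rat_absorbent scale U"
    and zero: "0 \<in> U" and x: "x \<notin> U"
  shows "1 \<le> gauge U x"
  unfolding gauge_def
proof (rule cInf_greatest[OF gauge_set_nonempty[OF absorbent]])
  fix r assume "r \<in> {real_of_rat t | t. 0 < t \<and> scale (1 / t) x \<in> U}"
  then obtain t where t: "0 < t" "scale (1 / t) x \<in> U" "r = of_rat t"
    by auto
  have "\<not> t \<le> 1"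
  proof
    assume "t \<le> 1"
    then have "scale t (scale (1 / t) x) + scale (1 - t) 0 \<in> U"
      using convex t zero by (auto simp: rat_convex_def simp del: scale_scale scale_zero_right)
    with t(1) x show False
      by simp
  qed
  then show "1 \<le> r"
    using t(3) by simp
qed

lemma gauge_le_0:
  assumes "\<And>c. 0 < c \<Longrightarrow> scale c y \<in> U"
  shows "gauge U y \<le> 0"
proof (rule ccontr)
  assume "\<not> gauge U y \<le> 0"
  then obtain t where t: "0 < real_of_rat t" "of_rat t < gauge U y"
    using of_rat_dense[of 0 "gauge U y"] by auto
  with gauge_le[of t y U] assms[of "1 / t"] show False
    by simp
qed

end

section \<open>Positive functionals detect the cone\<close>

theorem theorem6p15:
  fixes scale :: "rat \<Rightarrow> 'w \<Rightarrow> 'w::ab_group_add"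
    and pos_cone :: "'w set"
    and x :: 'w
  assumes "ordered_rat_vector_space scale pos_cone"
    and "archimedean_cone scale pos_cone"
  shows "cone_ge pos_cone x 0 \<longleftrightarrow> (\<forall>f. positive_functional pos_cone f \<longrightarrow> f x \<ge> 0)"
proof
  assume "cone_ge pos_cone x 0"
  then show "\<forall>f. positive_functional pos_cone f \<longrightarrow> f x \<ge> 0"
    by (simp add: positive_functional_def)
next
  assume nonneg: "\<forall>f. positive_functional pos_cone f \<longrightarrow> f x \<ge> 0"
  interpret ordered_rat_vector_space scale pos_cone
    by fact
  interpret rat_vector_space scale
    by unfold_locales
  show "cone_ge pos_cone x 0"
  proof (rule ccontr)
    assume "\<not> cone_ge pos_cone x 0"
    then have "x \<notin> pos_cone"
      by (simp add: cone_ge_def)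
    then obtain U where U: "rat_convex scale U" "pos_cone \<subseteq> U" "rat_absorbent scale U" "x \<notin> U"
      using assms(2) unfolding archimedean_cone_def absolutely_convex_def by blast
    obtain f where f: "additive f" "f \<le> gauge U" "f x = gauge U x"
      using Hahn_Banach_touching[OF sublinear_gauge[OF U(1,3)], of x] by blast
    have "f y \<le> 0" if "y \<in> pos_cone" for y
    proof -
      have "gauge U y \<le> 0"
        by (rule gauge_le_0) (use that U(2) scale_in_pos_cone in auto)
      with le_funD[OF f(2), of y] show ?thesis
        by simp
    qed
    then have "positive_functional pos_cone (\<lambda>y. - f y)"
      using f(1) by (simp add: positive_functional_def cone_ge_def additive_def)
    with nonneg have "f x \<le> 0"
      by fastforce
    moreover have "1 \<le> f x"
      using gauge_ge_1[OF U(1,3) _ U(4)] U(2) zero_in_pos_cone f(3) by auto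
    ultimately show False
      by simp
  qed
qed

end
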